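(* Let $p>0$ and let $n\ge1$ be an integer. Let $G=(g_1,\ldots,g_n)$ be a random vector whose coordinates are i.i.d. with density $e^{-|t|^p}/(2\Gamma(1+1/p))$, $t\in\mathbb{R}$. Let $W$ be a nonnegative random variable with distribution $h$, independent of $G$. Then the random vector $$\frac{G}{(\|G\|_p^p+W)^{1/p}}$$ generates the measure $h(\{0\})\mu_{B_p^n}+\Psi\lambda_{B_p^n}$ (i.e., this measure is its law), where $\lambda_{B_p^n}$ is Lebesgue measure restricted to $B_p^n$, $\mu_{B_p^n}$ is the cone measure on $\partial B_p^n$, and for $x\in B_p^n$, $\Psi(x)=\psi(\|x\|_p)$, where for $r\in[0,1)$ $$\left[2\Gamma\left(1+\frac1p\right)\right]^n\psi(r)=\frac{1}{(1-r^p)^{n/p+1}}\int_{(0,\infty)}w^{n/p}e^{-r^pw/(1-r^p)}\,dh(w).$$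
   Context: For $x\in\mathbb{R}^n$, $\|x\|_p=(\sum_{i=1}^n|x_i|^p)^{1/p}$ and $B_p^n=\{x\in\mathbb{R}^n:\|x\|_p\le1\}$. The cone measure $\mu_K$ on $\partial K$ (here $K=B_p^n$) is defined for measurable $A\subset\partial K$ by $\mu_K(A)=\mathrm{vol}(\{ta:a\in A,\,0\le t\le1\})/\mathrm{vol}(K)$. *)

theory Defs
  imports "HOL-Probability.Probability"
begin

(* For 0 < p < 1 this is only a quasi-norm; "0 powr p = 0" in Isabelle, which is the right value. *)
definition lp_norm :: "real \<Rightarrow> real ^ 'n \<Rightarrow> real"
  where "lp_norm p x = (\<Sum>i\<in>UNIV. \<bar>x $ i\<bar> powr p) powr (1 / p)"

definition lp_ball :: "real \<Rightarrow> (real ^ 'n) set"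
  where "lp_ball p = {x. lp_norm p x \<le> 1}"

definition cone_over :: "'a::real_vector set \<Rightarrow> 'a set"
  where "cone_over A = {t *\<^sub>R a |t a. a \<in> A \<and> 0 \<le> t \<and> t \<le> 1}"

(* A measure on all of the ambient space, concentrated on the frontier of K.
   "measure_of" yields the null measure if the given set function is not a measure; the lemma
   emeasure_cone_measure_lp_ball below shows that this does not happen for the balls. *)
definition cone_measure :: "'a::euclidean_space set \<Rightarrow> 'a measure"
  where "cone_measure K = measure_of UNIV (sets borel)
    (\<lambda>A. emeasure lebesgue (cone_over (A \<inter> frontier K)) / emeasure lebesgue K)"

(* The value is an extended nonnegative real because the integral may be infinite at r = 0.
   For r = 1 the value is junk (0, by division by 0). *)
definition psi :: "real \<Rightarrow> nat \<Rightarrow> real measure \<Rightarrow> real \<Rightarrow> ennreal"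
  where "psi p n h r =
    ennreal (1 / (1 - r powr p) powr (real n / p + 1)) *
    (\<integral>\<^sup>+ w \<in> {0<..}. ennreal (w powr (real n / p) * exp (- (r powr p * w / (1 - r powr p)))) \<partial>h)
    / ennreal ((2 * Gamma (1 + 1 / p)) ^ n)"

lemma lp_norm_scaleR:
  assumes "0 < p" "0 \<le> t"
  shows "lp_norm p (t *\<^sub>R x) = t * lp_norm p x"
proof -
  have "(\<Sum>i\<in>UNIV. \<bar>(t *\<^sub>R x) $ i\<bar> powr p) = t powr p * (\<Sum>i\<in>UNIV. \<bar>x $ i\<bar> powr p)"
    using assms by (simp add: abs_mult powr_mult sum_distrib_left)
  then show ?thesis
    using assms by (simp add: lp_norm_def powr_mult sum_nonneg powr_powr)
qed

lemma lp_norm_nonneg: "0 \<le> lp_norm p x"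
  by (simp add: lp_norm_def)

lemma continuous_on_lp_norm:
  assumes "0 < p"
  shows "continuous_on UNIV (lp_norm p :: real ^ 'n \<Rightarrow> real)"
  unfolding lp_norm_def using assms
  by (intro continuous_on_powr' continuous_intros) (auto intro: sum_nonneg)

lemma borel_measurable_lp_norm [measurable]:
  assumes "0 < p"
  shows "(lp_norm p :: real ^ 'n \<Rightarrow> real) \<in> borel_measurable borel"
  by (intro borel_measurable_continuous_onI continuous_on_lp_norm assms)

lemma frontier_lp_ball_subset:
  assumes "0 < p"
  shows "frontier (lp_ball p) \<subseteq> {x :: real ^ 'n. lp_norm p x = 1}"
proof -
  have cl: "closed (lp_ball p :: (real ^ 'n) set)"
    unfolding lp_ball_def
    by (intro closed_Collect_le continuous_on_lp_norm assms continuous_intros)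
  have "{x :: real ^ 'n. lp_norm p x < 1} \<subseteq> interior (lp_ball p)"
    by (intro interior_maximal open_Collect_less continuous_on_lp_norm assms continuous_intros)
      (auto simp: lp_ball_def)
  with cl show ?thesis
    by (force simp: frontier_def lp_ball_def)
qed

lemma emeasure_cone_measure_lp_ball:
  fixes A :: "(real ^ 'n) set"
  assumes p: "0 < p" and A: "A \<in> sets borel"
  shows "emeasure (cone_measure (lp_ball p)) A =
    emeasure lebesgue (cone_over (A \<inter> frontier (lp_ball p))) /
    emeasure lebesgue (lp_ball p :: (real ^ 'n) set)"
proof -
  note [measurable] = borel_measurable_lp_norm[OF p]
  define F where "F = frontier (lp_ball p :: (real ^ 'n) set)"
  have F1: "lp_norm p x = 1" if "x \<in> F" for x
    using frontier_lp_ball_subset[OF p] that by (auto simp: F_def)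
  have [measurable]: "F \<in> sets borel"
    by (simp add: F_def borel_closed)
  define c where "c B = {x. x \<noteq> 0 \<and> lp_norm p x \<le> 1 \<and> (1 / lp_norm p x) *\<^sub>R x \<in> B \<inter> F}" for B
  have c_cone: "c B = cone_over (B \<inter> F) - {0}" for B
  proof (intro set_eqI iffI)
    fix x assume x: "x \<in> c B"
    then have "lp_norm p x \<noteq> 0" using F1[of 0] F1[of "(1 / lp_norm p x) *\<^sub>R x"]
      by (auto simp: c_def lp_norm_def)
    then have "x = lp_norm p x *\<^sub>R ((1 / lp_norm p x) *\<^sub>R x)" by simp
    then show "x \<in> cone_over (B \<inter> F) - {0}"
      using x lp_norm_nonneg[of p x] unfolding cone_over_def c_def by blast
  next
    fix x assume "x \<in> cone_over (B \<inter> F) - {0}"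
    then obtain t a where "x = t *\<^sub>R a" "a \<in> B \<inter> F" "0 \<le> t" "t \<le> 1" "x \<noteq> 0"
      by (auto simp: cone_over_def)
    then show "x \<in> c B"
      using F1[of a] by (auto simp: c_def lp_norm_scaleR[OF p])
  qed
  have c_meas: "c B \<in> sets borel" if [measurable]: "B \<in> sets borel" for B
    unfolding c_def by measurable
  have e_c: "emeasure lebesgue (cone_over (B \<inter> F)) = emeasure lborel (c B)" if "B \<in> sets borel" for B
  proof -
    have "cone_over (B \<inter> F) \<in> {c B, insert 0 (c B)}"
      unfolding c_cone by auto
    then have m: "cone_over (B \<inter> F) \<in> sets borel"
      using c_meas[OF that] by auto
    have "emeasure lborel (c B) = emeasure lborel (cone_over (B \<inter> F))"
      unfolding c_cone using m by (intro emeasure_Diff_null_set) auto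
    then show ?thesis using m by simp
  qed
  have cm: "cone_measure (lp_ball p :: (real ^ 'n) set) = measure_of UNIV (sets borel)
      (\<lambda>B. emeasure lebesgue (cone_over (B \<inter> F)) / emeasure lebesgue (lp_ball p :: (real ^ 'n) set))"
    by (simp add: cone_measure_def F_def)
  show ?thesis
    unfolding F_def[symmetric]
  proof (rule emeasure_measure_of[OF cm])
    let ?M = "cone_measure (lp_ball p :: (real ^ 'n) set)"
    let ?\<mu> = "\<lambda>B. emeasure lebesgue (cone_over (B \<inter> F)) / emeasure lebesgue (lp_ball p :: (real ^ 'n) set)"
    have sets: "sets ?M = sets borel"
      using sets.sigma_sets_eq[of "borel :: (real ^ 'n) measure"]
      by (simp add: cone_measure_def)
    show "A \<in> sets ?M" using A sets by simp
    show "positive (sets ?M) ?\<mu>"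
      by (simp add: positive_def cone_over_def)
    show "countably_additive (sets ?M) ?\<mu>"
      unfolding sets
    proof (rule countably_additiveI)
      fix B :: "nat \<Rightarrow> (real ^ 'n) set"
      assume B: "range B \<subseteq> sets borel" and d: "disjoint_family B"
      have "(\<Sum>i. emeasure lborel (c (B i))) = emeasure lborel (\<Union>i. c (B i))"
        using B d c_meas by (intro suminf_emeasure) (auto simp: disjoint_family_on_def c_def)
      also have "(\<Union>i. c (B i)) = c (\<Union>i. B i)"
        by (auto simp: c_def)
      finally have "(\<Sum>i. emeasure lborel (c (B i))) = emeasure lborel (c (\<Union>i. B i))" .
      moreover have "(\<Union>i. B i) \<in> sets borel" using B by blast
      ultimately show "(\<Sum>i. ?\<mu> (B i)) = ?\<mu> (\<Union>i. B i)"
        using B by (simp add: e_c subset_eq divide_ennreal_def)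
    qed
  qed auto
qed

end

theory Submission
  imports Defs
begin

text \<open>
  In the polar coordinates x = r u with r the p-norm of x, Lebesgue measure splits as
  n r^(n-1) dr times a finite measure on the unit sphere, a multiple of the cone measure; only the
  homogeneity of the p-norm matters, so p < 1 needs no separate treatment and the sphere no smoothness.
  The law of G has density proportional to exp(- r^p). Conditionally on W = w > 0 the map
  x \<mapsto> x / (r^p + w)^(1/p) keeps u and acts on r by a diffeomorphism of (0, \<infinity>) onto (0, 1), and the
  one-dimensional substitution produces the integrand of psi. For w = 0 the map
  sends x to u, which gives the cone measure; its constant is read off from total mass 1, without
  computing the volume of the ball.
\<close>

subsection \<open>Independent coordinates and one-dimensional substitution\<close>

text \<open>Open boxes generate the Borel sets and are closed under intersection. On a box both
  measures are the same product of one-dimensional integrals: on the left by independence, on the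
  right by Tonelli for Lebesgue measure as a product.\<close>

lemma distr_vec_eq_density:
  fixes G :: "'a \<Rightarrow> real ^ 'n" and f :: "'n \<Rightarrow> real \<Rightarrow> ennreal"
  assumes M: "prob_space M"
    and ind: "prob_space.indep_vars M (\<lambda>_. borel) (\<lambda>i \<omega>. G \<omega> $ i) UNIV"
    and d: "\<And>i. distributed M lborel (\<lambda>\<omega>. G \<omega> $ i) (f i)"
    and G[measurable]: "G \<in> borel_measurable M"
  shows "distr M borel G = density lborel (\<lambda>x. \<Prod>i\<in>UNIV. f i (x $ i))"
proof -
  interpret prob_space M by fact
  have f[measurable]: "f i \<in> borel_measurable borel" for i
    using distributed_borel_measurable[OF d[of i]] by simp
  \<comment> \<open>The product formula for \<open>lborel\<close> runs over \<open>Basis\<close>,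
    the densities over coordinates; this bijection translates between the two index sets.\<close>
  have bij: "bij_betw (\<lambda>i::'n. axis i (1::real)) UNIV Basis"
    by (auto simp: bij_betw_def inj_on_def axis_eq_axis Basis_vec_def)
  show ?thesis
  proof (rule measure_eqI_generator_eq)
    let ?E = "range (\<lambda>(a, b). box a b :: (real ^ 'n) set)"
    show "Int_stable ?E"
      by (auto simp: Int_stable_def box_Int_box)
    show "?E \<subseteq> Pow UNIV" by simp
    show "sets (distr M borel G) = sigma_sets UNIV ?E"
      "sets (density lborel (\<lambda>x. \<Prod>i\<in>UNIV. f i (x $ i))) = sigma_sets UNIV ?E"
      by (simp_all add: borel_eq_box)
    let ?A = "\<lambda>n::nat. box (- (real n *\<^sub>R One)) (real n *\<^sub>R One) :: (real ^ 'n) set"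
    show "range ?A \<subseteq> ?E" "(\<Union>i. ?A i) = UNIV"
      unfolding UN_box_eq_UNIV by auto
    interpret D: prob_space "distr M borel G" by (intro prob_space_distr G)
    show "emeasure (distr M borel G) (?A i) \<noteq> \<infinity>" for i
      by simp
    fix X assume "X \<in> ?E"
    then obtain a b where X: "X = box a b" by auto
    let ?I = "\<lambda>i. {a $ i <..< b $ i}"
    \<comment> \<open>The density of a coordinate cut off to its side of the box, reindexed by basis
      vectors.\<close>
    define g where "g c t = f (inv_into UNIV (\<lambda>i::'n. axis i (1::real)) c) t *
      indicator (?I (inv_into UNIV (\<lambda>i::'n. axis i (1::real)) c)) t" for c t
    have inv: "inv_into UNIV (\<lambda>i::'n. axis i (1::real)) (axis i 1) = i" for i
      using bij by (intro inv_into_f_f) (auto simp: bij_betw_def)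
    have "emeasure (distr M borel G) X = emeasure M (\<Inter>i\<in>UNIV. (\<lambda>\<omega>. G \<omega> $ i) -` ?I i \<inter> space M)"
      unfolding X by (subst emeasure_distr) (auto simp: mem_box_cart intro!: arg_cong[where f="emeasure M"])
    also have "\<dots> = (\<Prod>i\<in>UNIV. emeasure M ((\<lambda>\<omega>. G \<omega> $ i) -` ?I i \<inter> space M))"
      unfolding emeasure_eq_measure
      by (subst indep_varsD_finite[OF ind]) (auto simp: prod_ennreal)
    also have "\<dots> = (\<Prod>i\<in>UNIV. \<integral>\<^sup>+t. g (axis i 1) t \<partial>lborel)"
      by (intro prod.cong refl) (simp add: distributed_emeasure[OF d] g_def inv)
    also have "\<dots> = (\<Prod>c\<in>Basis. \<integral>\<^sup>+t. g c t \<partial>lborel)"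
      by (rule prod.reindex_bij_betw[OF bij])
    also have "\<dots> = (\<integral>\<^sup>+x. (\<Prod>c\<in>Basis. g c (x \<bullet> c)) \<partial>(lborel :: (real^'n) measure))"
      by (subst nn_integral_lborel_prod) (auto simp: g_def[abs_def])
    also have "\<dots> = (\<integral>\<^sup>+x. (\<Prod>i\<in>UNIV. f i (x $ i)) * indicator X x \<partial>lborel)"
    proof (intro nn_integral_cong)
      fix x :: "real ^ 'n"
      have "(\<Prod>c\<in>Basis. g c (x \<bullet> c)) = (\<Prod>i\<in>UNIV. g (axis i 1) (x \<bullet> axis i 1))"
        by (rule prod.reindex_bij_betw[OF bij, symmetric])
      also have "\<dots> = (\<Prod>i\<in>UNIV. f i (x $ i) * indicator (?I i) (x $ i))"
        by (simp add: g_def inv inner_axis)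
      also have "\<dots> = (\<Prod>i\<in>UNIV. f i (x $ i)) * indicator X x"
      proof (cases "x \<in> X")
        case True
        then show ?thesis by (simp add: X mem_box_cart)
      next
        \<comment> \<open>Outside the box some coordinate leaves its interval, and that single
          factor kills the product.\<close>
        case False
        then obtain i where "x $ i \<notin> ?I i" by (auto simp: X mem_box_cart)
        then have "(\<Prod>i\<in>UNIV. f i (x $ i) * indicator (?I i) (x $ i)) = 0"
          by (intro prod_zero) (auto intro!: exI[of _ i])
        with False show ?thesis by simp
      qed
      finally show "(\<Prod>c\<in>Basis. g c (x \<bullet> c)) = (\<Prod>i\<in>UNIV. f i (x $ i)) * indicator X x" .
    qed
    also have "\<dots> = emeasure (density lborel (\<lambda>x. \<Prod>i\<in>UNIV. f i (x $ i))) X"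
      by (subst emeasure_density) (auto simp: X)
    finally show "emeasure (distr M borel G) X = emeasure (density lborel (\<lambda>x. \<Prod>i\<in>UNIV. f i (x $ i))) X" .
  qed
qed

text \<open>The substitution rule on compact intervals \<open>{a n..b n}\<close> inside (0, 1)
  passes to the limit by monotone convergence. The boundary limits of \<open>g\<close> make the
  images of these intervals exhaust the positive half-line.\<close>

lemma nn_integral_substitution_open:
  fixes f :: "real \<Rightarrow> ennreal"
  assumes f[measurable]: "f \<in> borel_measurable borel"
    and deriv: "\<And>x. 0 < x \<Longrightarrow> x < 1 \<Longrightarrow> (g has_real_derivative g' x) (at x)"
    and cont: "continuous_on {0<..<1} g'"
    and nn: "\<And>x. 0 < x \<Longrightarrow> x < 1 \<Longrightarrow> 0 \<le> g' x"
    and pos: "\<And>x. 0 < x \<Longrightarrow> x < 1 \<Longrightarrow> 0 < g x"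
    and lim0: "(g \<longlongrightarrow> 0) (at_right 0)"
    and lim1: "filterlim g at_top (at_left 1)"
  shows "(\<integral>\<^sup>+x. f x * indicator {0<..} x \<partial>lborel) =
    (\<integral>\<^sup>+x. f (g x) * ennreal (g' x) * indicator {0<..<1} x \<partial>lborel)"
proof -
  \<comment> \<open>The offset 3 gives \<open>a n < b n\<close> already for \<open>n = 0\<close>;
    with 2 the first interval would be a single point.\<close>
  define a where "a n = 1 / real (n + 3)" for n :: nat
  define b where "b n = 1 - a n" for n
  have a: "0 < a n" "a n < b n" "b n < 1" for n
    by (auto simp: a_def b_def field_simps)
  have a_mono: "a n \<le> a m" if "m \<le> n" for m n
    using that by (auto simp: a_def field_simps)
  have lima: "filterlim a (at_right 0) sequentially"
    unfolding a_def by real_asymp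
  have limb: "filterlim b (at_left 1) sequentially"
    unfolding a_def b_def by real_asymp
  have mono: "g x \<le> g y" if "0 < x" "x \<le> y" "y < 1" for x y
    using that by (intro DERIV_nonneg_imp_nondecreasing[of x y g]) (auto intro!: exI[of _ "g' _"] deriv nn)
  \<comment> \<open>For fixed positive \<open>x\<close>, \<open>g (a n)\<close> eventually falls
    below \<open>x\<close> by \<open>lim0\<close> and \<open>g (b n)\<close> rises above it by
    \<open>lim1\<close>.\<close>
  have sup1: "(SUP n. indicator {g (a n)..g (b n)} x) = (indicator {0<..} x :: ennreal)" for x
  proof (cases "0 < x")
    case True
    have "eventually (\<lambda>n. g (a n) < x) sequentially"
      using order_tendstoD(2)[OF lim0 True] lima by (auto simp: filterlim_iff)
    moreover have "eventually (\<lambda>n. x \<le> g (b n)) sequentially"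
      using filterlim_compose[OF lim1 limb] by (auto simp: filterlim_at_top)
    ultimately have "eventually (\<lambda>n. x \<in> {g (a n)..g (b n)}) sequentially"
      by eventually_elim auto
    then obtain n where "x \<in> {g (a n)..g (b n)}" by (auto simp: eventually_sequentially)
    then show ?thesis
      using True by (intro antisym SUP_least SUP_upper2[of n]) (auto simp: indicator_def)
  next
    case False
    then have "x \<notin> {g (a n)..g (b n)}" for n using pos[of "a n"] a[of n] by auto
    then show ?thesis using False by (simp add: bot_ennreal)
  qed
  have sup2: "(SUP n. indicator {a n..b n} x) = (indicator {0<..<1} x :: ennreal)" for x
  proof (cases "x \<in> {0<..<1}")
    case True
    have "eventually (\<lambda>n. a n < x) sequentially"
      using lima True order_tendstoD(2)[of a 0] by (auto simp: filterlim_at)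
    moreover have "eventually (\<lambda>n. x < b n) sequentially"
      using limb True order_tendstoD(1)[of b 1] by (auto simp: filterlim_at)
    ultimately have "eventually (\<lambda>n. x \<in> {a n..b n}) sequentially"
      by eventually_elim auto
    then obtain n where "x \<in> {a n..b n}" by (auto simp: eventually_sequentially)
    then show ?thesis
      using True by (intro antisym SUP_least SUP_upper2[of n]) (auto simp: indicator_def)
  next
    case False
    have "x \<notin> {a n..b n}" for n
    proof
      assume "x \<in> {a n..b n}"
      then have "x \<in> {0<..<1}" using a[of n] by auto
      with False show False by blast
    qed
    then show ?thesis using False by (simp add: bot_ennreal)
  qed
  have inc1: "incseq (\<lambda>n x. f x * indicator {g (a n)..g (b n)} x)"
  proof (intro incseq_SucI le_funI mult_left_mono)
    fix n x
    have "g (a (Suc n)) \<le> g (a n)" "g (b n) \<le> g (b (Suc n))"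
      using a[of n] a[of "Suc n"] a_mono[of n "Suc n"] by (auto intro!: mono simp: b_def)
    then show "indicator {g (a n)..g (b n)} x \<le> (indicator {g (a (Suc n))..g (b (Suc n))} x :: ennreal)"
      by (auto simp: indicator_def)
  qed simp
  \<comment> \<open>Nothing is assumed about \<open>g\<close> and \<open>g'\<close> outside (0, 1),
    so measurability is obtained for the integrand cut off to that interval, by way of the truncated
    functions below.\<close>
  define h where "h x = ennreal (g' x) * f (g x) * indicator {0<..<1} x" for x
  have gm: "(\<lambda>x. if x \<in> {0<..<1} then g x else 0) \<in> borel_measurable borel"
    by (intro borel_measurable_continuous_on_if continuous_on_const)
      (auto intro!: continuous_at_imp_continuous_on DERIV_isCont[OF deriv])
  have g'm: "(\<lambda>x. if x \<in> {0<..<1} then g' x else 0) \<in> borel_measurable borel"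
    by (intro borel_measurable_continuous_on_if cont continuous_on_const) auto
  note [measurable] = gm g'm
  have "h = (\<lambda>x. ennreal (if x \<in> {0<..<1} then g' x else 0) *
      f (if x \<in> {0<..<1} then g x else 0) * indicator {0<..<1} x)"
    by (auto simp: h_def fun_eq_iff indicator_def)
  then have h[measurable]: "h \<in> borel_measurable borel"
    by (simp only:) measurable
  have inc2: "incseq (\<lambda>n x. h x * indicator {a n..b n} x)"
    using a_mono[OF le_SucI[OF order_refl]]
    by (intro incseq_SucI le_funI mult_left_mono) (auto simp: b_def indicator_def intro: order_trans)
  have "(\<integral>\<^sup>+x. f x * indicator {0<..} x \<partial>lborel) =
    (\<integral>\<^sup>+x. (SUP n. f x * indicator {g (a n)..g (b n)} x) \<partial>lborel)"
    by (simp add: sup1 SUP_mult_left_ennreal[symmetric])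
  also have "\<dots> = (SUP n. \<integral>\<^sup>+x. f x * indicator {g (a n)..g (b n)} x \<partial>lborel)"
    by (rule nn_integral_monotone_convergence_SUP[OF inc1]) simp
  also have "\<dots> = (SUP n. \<integral>\<^sup>+x. h x * indicator {a n..b n} x \<partial>lborel)"
  proof (intro SUP_cong refl)
    fix n
    have "(\<integral>\<^sup>+x. f x * indicator {g (a n)..g (b n)} x \<partial>lborel) =
      (\<integral>\<^sup>+x. f (g x) * ennreal (g' x) * indicator {a n..b n} x \<partial>lborel)"
      using a[of n] by (intro nn_integral_substitution_aux deriv nn f continuous_on_subset[OF cont]) auto
    also have "\<dots> = (\<integral>\<^sup>+x. h x * indicator {a n..b n} x \<partial>lborel)"
      using a[of n] by (intro nn_integral_cong) (auto simp: h_def indicator_def mult_ac)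
    finally show "(\<integral>\<^sup>+x. f x * indicator {g (a n)..g (b n)} x \<partial>lborel) = (\<integral>\<^sup>+x. h x * indicator {a n..b n} x \<partial>lborel)" .
  qed
  also have "\<dots> = (\<integral>\<^sup>+x. (SUP n. h x * indicator {a n..b n} x) \<partial>lborel)"
    by (rule nn_integral_monotone_convergence_SUP[OF inc2, symmetric]) simp
  also have "\<dots> = (\<integral>\<^sup>+x. f (g x) * ennreal (g' x) * indicator {0<..<1} x \<partial>lborel)"
    unfolding SUP_mult_left_ennreal[symmetric] sup2
    by (intro nn_integral_cong) (auto simp: h_def indicator_def mult_ac)
  finally show ?thesis .
qed

subsection \<open>Polar coordinates for the p-norm\<close>

lemma lp_norm_eq_0_iff: "0 < p \<Longrightarrow> lp_norm p x = 0 \<longleftrightarrow> x = 0"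
  by (auto simp: lp_norm_def sum_nonneg_eq_0_iff vec_eq_iff)

lemma lp_norm_powr: "0 < p \<Longrightarrow> lp_norm p x powr p = (\<Sum>i\<in>UNIV. \<bar>x $ i\<bar> powr p)"
  by (simp add: lp_norm_def powr_powr sum_nonneg)

lemma abs_nth_le_lp_norm:
  assumes "0 < p" shows "\<bar>x $ i\<bar> \<le> lp_norm p x"
proof -
  have "\<bar>x $ i\<bar> = (\<bar>x $ i\<bar> powr p) powr (1 / p)"
    using assms by (simp add: powr_powr)
  also have "\<dots> \<le> lp_norm p x"
    unfolding lp_norm_def using assms
    by (intro powr_mono2 member_le_sum) auto
  finally show ?thesis .
qed

lemma lp_ball_borel [measurable]: "0 < p \<Longrightarrow> (lp_ball p :: (real ^ 'n) set) \<in> sets borel"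
  unfolding lp_ball_def by measurable

text \<open>Each coordinate is dominated by the p-norm, so the ball lies in the cube with vertices
  at plus and minus 1.\<close>

lemma emeasure_lp_ball_finite:
  assumes "0 < p" shows "emeasure lborel (lp_ball p :: (real ^ 'n) set) < \<infinity>"
proof -
  have "\<bar>x $ i\<bar> \<le> 1" if "x \<in> lp_ball p" for x :: "real ^ 'n" and i
    using that abs_nth_le_lp_norm[OF assms, of x i] by (simp add: lp_ball_def)
  then have "lp_ball p \<subseteq> (cbox (- 1) 1 :: (real ^ 'n) set)"
    by (auto simp: mem_box_cart abs_le_iff minus_le_iff)
  then have "emeasure lborel (lp_ball p :: (real ^ 'n) set) \<le> emeasure lborel (cbox (- 1) 1 :: (real ^ 'n) set)"
    by (intro emeasure_mono) auto
  also have "\<dots> < \<infinity>" by (rule emeasure_lborel_cbox_finite)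
  finally show ?thesis .
qed

text \<open>By homogeneity a point of norm 1 is the limit of its multiples by
  \<open>1 + 1 / Suc n\<close>, which have norm above 1; hence it is not interior.\<close>

lemma frontier_lp_ball:
  assumes p: "0 < p"
  shows "frontier (lp_ball p) = {x :: real ^ 'n. lp_norm p x = 1}"
proof (intro equalityI frontier_lp_ball_subset p subsetI)
  fix x :: "real ^ 'n" assume x: "x \<in> {x. lp_norm p x = 1}"
  have "x \<notin> interior (lp_ball p)"
  proof
    assume "x \<in> interior (lp_ball p)"
    then have "eventually (\<lambda>y. y \<in> lp_ball p) (nhds x)"
      using eventually_nhds_in_open[of "interior (lp_ball p)" x] interior_subset[of "lp_ball p :: (real ^ 'n) set"]
      by (auto elim: eventually_mono)
    moreover have "filterlim (\<lambda>n. (1 + 1 / real (Suc n)) *\<^sub>R x) (nhds ((1 + 0) *\<^sub>R x)) sequentially"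
      by (intro tendsto_intros LIMSEQ_Suc[OF lim_1_over_n])
    ultimately have "eventually (\<lambda>n. (1 + 1 / real (Suc n)) *\<^sub>R x \<in> lp_ball p) sequentially"
      by (auto simp: filterlim_iff)
    then obtain n where "(1 + 1 / real (Suc n)) *\<^sub>R x \<in> lp_ball p"
      by (auto simp: eventually_sequentially)
    then show False
      using x p by (simp add: lp_ball_def lp_norm_scaleR)
  qed
  moreover have "x \<in> lp_ball p" using x by (simp add: lp_ball_def)
  ultimately show "x \<in> frontier (lp_ball p)"
    using closure_subset[of "lp_ball p :: (real ^ 'n) set"] by (auto simp: frontier_def)
qed

section \<open>Directions, the surface measure and the cone measure\<close>

definition lp_direction :: "real \<Rightarrow> real ^ 'n \<Rightarrow> real ^ 'n"
  where "lp_direction p x = (1 / lp_norm p x) *\<^sub>R x"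

lemma borel_measurable_lp_direction [measurable]:
  "0 < p \<Longrightarrow> (lp_direction p :: real ^ 'n \<Rightarrow> real ^ 'n) \<in> borel_measurable borel"
  unfolding lp_direction_def by measurable

lemma lp_norm_direction:
  assumes "0 < p" "x \<noteq> 0" shows "lp_norm p (lp_direction p x) = 1"
  using assms lp_norm_eq_0_iff[of p x] lp_norm_nonneg[of p x]
  by (simp add: lp_direction_def lp_norm_scaleR)

lemma lp_direction_scaleR:
  assumes "0 < p" "0 < t" shows "lp_direction p (t *\<^sub>R x) = lp_direction p x"
  using assms by (simp add: lp_direction_def lp_norm_scaleR)

text \<open>The unnormalised cone measure: the mass of \<open>B\<close> is the volume of the part of
  the ball whose directions lie in \<open>B\<close>. As an image measure it is countably additive by
  construction; it lives on the whole space and is concentrated on the unit sphere.\<close>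

definition lp_surface :: "real \<Rightarrow> (real ^ 'n) measure"
  where "lp_surface p = distr (density lborel (indicator (lp_ball p))) borel (lp_direction p)"

lemma sets_lp_surface [simp, measurable_cong]: "sets (lp_surface p) = sets borel"
  by (simp add: lp_surface_def)

lemma space_lp_surface [simp]: "space (lp_surface p) = UNIV"
  by (simp add: lp_surface_def)

lemma emeasure_lp_surface:
  assumes p: "0 < p" and [measurable]: "B \<in> sets borel"
  shows "emeasure (lp_surface p) B = emeasure lborel {x. lp_norm p x \<le> 1 \<and> lp_direction p x \<in> B}"
proof -
  note [measurable] = lp_ball_borel[OF p] borel_measurable_lp_direction[OF p] borel_measurable_lp_norm[OF p]
  have [measurable]: "lp_direction p -` B \<in> sets borel"
    using measurable_sets[OF borel_measurable_lp_direction[OF p], of B] by simp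
  have "emeasure (lp_surface p) B =
      (\<integral>\<^sup>+x. indicator (lp_ball p) x * indicator (lp_direction p -` B) x \<partial>lborel)"
    by (simp add: lp_surface_def emeasure_distr emeasure_density)
  also have "\<dots> = (\<integral>\<^sup>+x. indicator {x. lp_norm p x \<le> 1 \<and> lp_direction p x \<in> B} x \<partial>lborel)"
    by (intro nn_integral_cong) (auto simp: indicator_def lp_ball_def)
  finally show ?thesis
    by simp
qed

lemma emeasure_lp_surface_UNIV:
  "0 < p \<Longrightarrow> emeasure (lp_surface p :: (real ^ 'n) measure) UNIV = emeasure lborel (lp_ball p :: (real ^ 'n) set)"
  by (subst emeasure_lp_surface) (auto simp: lp_ball_def)

lemma finite_measure_lp_surface:
  assumes "0 < p" shows "finite_measure (lp_surface p :: (real ^ 'n) measure)"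
  by (rule finite_measureI)
    (use assms emeasure_lp_ball_finite[OF assms, where 'n='n] in \<open>simp add: emeasure_lp_surface_UNIV less_top\<close>)

text \<open>The origin, whose direction is 0 through division by zero, is the only point with a
  direction off the unit sphere, and it is a null set.\<close>

lemma AE_lp_surface:
  assumes p: "0 < p" shows "AE u in lp_surface p. lp_norm p (u :: real ^ 'n) = 1"
proof -
  note [measurable] = lp_ball_borel[OF p] borel_measurable_lp_direction[OF p] borel_measurable_lp_norm[OF p]
  have "AE x in density lborel (indicator (lp_ball p)). lp_norm p (lp_direction p (x :: real ^ 'n)) = 1"
    using AE_lborel_singleton[of "0 :: real ^ 'n"]
    by (subst AE_density) (auto elim!: eventually_mono intro: lp_norm_direction p)
  then show ?thesis
    unfolding lp_surface_def by (subst AE_distr_iff) auto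
qed

text \<open>The cone over \<open>A\<close> and the set of ball points with direction in
  \<open>A\<close> differ at most in the origin, so the cone measure is \<open>lp_surface\<close>
  divided by the volume of the ball.\<close>

lemma emeasure_cone_measure_eq_lp_surface:
  fixes A :: "(real ^ 'n) set"
  assumes p: "0 < p" and A[measurable]: "A \<in> sets borel"
  shows "emeasure (cone_measure (lp_ball p)) A =
    emeasure (lp_surface p) A / emeasure lborel (lp_ball p :: (real ^ 'n) set)"
proof -
  note [measurable] = borel_measurable_lp_direction[OF p] borel_measurable_lp_norm[OF p]
  let ?C = "cone_over (A \<inter> frontier (lp_ball p))"
  let ?S = "{x. lp_norm p x \<le> 1 \<and> lp_direction p x \<in> A}"
  have S: "?S \<in> sets borel" by measurable
  have "x \<in> ?C \<longleftrightarrow> x \<in> ?S" if x: "x \<noteq> 0" for x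
  proof
    assume "x \<in> ?C"
    then obtain t a where ta: "x = t *\<^sub>R a" "a \<in> A" "lp_norm p a = 1" "0 \<le> t" "t \<le> 1"
      unfolding cone_over_def frontier_lp_ball[OF p] by blast
    with x have "0 < t" by (cases "t = 0") auto
    with ta have "lp_norm p x = t" "lp_direction p x = a"
      by (simp_all add: lp_norm_scaleR[OF p] lp_direction_scaleR[OF p]) (simp add: lp_direction_def)
    with ta show "x \<in> ?S" by simp
  next
    assume S: "x \<in> ?S"
    have "x = lp_norm p x *\<^sub>R lp_direction p x"
      using x lp_norm_eq_0_iff[OF p, of x] by (simp add: lp_direction_def)
    moreover have "lp_direction p x \<in> A \<inter> frontier (lp_ball p)"
      using S lp_norm_direction[OF p x] by (simp add: frontier_lp_ball[OF p])
    ultimately show "x \<in> ?C"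
      using S lp_norm_nonneg[of p x] unfolding cone_over_def mem_Collect_eq by blast
  qed
  then have eq: "?C - {0} = ?S - {0}"
    by blast
  \<comment> \<open>The cone is defined as an image, so its measurability is inferred from that of
    \<open>?S\<close>, with which it agrees away from the origin.\<close>
  have "?C = ?C - {0} \<or> ?C = insert 0 (?C - {0})"
    by blast
  moreover have "?C - {0} \<in> sets borel" "insert 0 (?C - {0}) \<in> sets borel"
    unfolding eq using S by auto
  ultimately have C: "?C \<in> sets borel"
    by metis
  have "emeasure lborel ?C = emeasure lborel (?C - {0})"
    using C by (intro emeasure_Diff_null_set[symmetric]) auto
  also have "\<dots> = emeasure lborel ?S"
    unfolding eq using S by (intro emeasure_Diff_null_set) auto
  finally show ?thesis
    using C lp_ball_borel[OF p, where 'n='n] by (simp add: emeasure_cone_measure_lp_ball[OF p A] emeasure_lp_surface[OF p A])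
qed

section \<open>The radial measure and integration in polar coordinates\<close>

definition radial_measure :: "nat \<Rightarrow> real measure"
  where "radial_measure n = density lborel (\<lambda>r. ennreal (real n * r ^ (n - 1)) * indicator {0<..} r)"

lemma sets_radial_measure [simp, measurable_cong]: "sets (radial_measure n) = sets borel"
  by (simp add: radial_measure_def)

lemma space_radial_measure [simp]: "space (radial_measure n) = UNIV"
  by (simp add: radial_measure_def)

text \<open>\<open>r ^ n\<close> is an antiderivative of the density. The factor \<open>n\<close> in
  the density gives the unit interval mass 1, so that \<open>lp_surface\<close> carries the whole
  volume of the ball and no constant appears in the polar formula.\<close>

lemma emeasure_radial_measure_atMost:
  assumes "0 < n"
  shows "emeasure (radial_measure n) {..a} = ennreal ((max 0 a) ^ n)"
proof -
  have "emeasure (radial_measure n) {..a} =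
      (\<integral>\<^sup>+r. ennreal (real n * r ^ (n - 1)) * indicator {0<..} r * indicator {..a} r \<partial>lborel)"
    by (simp add: radial_measure_def emeasure_density)
  also have "\<dots> = (\<integral>\<^sup>+r. ennreal (real n * r ^ (n - 1)) * indicator {0..max 0 a} r \<partial>lborel)"
    using AE_lborel_singleton[of "0::real"]
    by (intro nn_integral_cong_AE) (auto elim!: eventually_mono simp: indicator_def)
  also have "\<dots> = ennreal ((max 0 a) ^ n - 0 ^ n)"
    by (rule nn_integral_FTC_Icc) (auto intro!: derivative_eq_intros)
  finally show ?thesis using assms by simp
qed

lemma sigma_finite_radial_measure:
  assumes "0 < n" shows "sigma_finite_measure (radial_measure n)"
proof
  have "(\<Union>i. {..real i}) = UNIV" by (auto simp: real_arch_simple)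
  then show "\<exists>A. countable A \<and> A \<subseteq> sets (radial_measure n) \<and>
      \<Union> A = space (radial_measure n) \<and> (\<forall>a\<in>A. emeasure (radial_measure n) a \<noteq> \<infinity>)"
    using assms by (intro exI[of _ "range (\<lambda>i. {..real i})"]) (auto simp: emeasure_radial_measure_atMost)
qed

text \<open>The scaling law of Lebesgue measure, phrased with a preimage because homogeneity of norm
  and direction rewrites membership of \<open>c *\<^sub>R x\<close> directly.\<close>

lemma emeasure_lborel_scaleR_vimage:
  fixes S :: "'a::euclidean_space set"
  assumes "0 < c" "S \<in> sets borel"
  shows "emeasure lborel S = ennreal (c ^ DIM('a)) * emeasure lborel {x. c *\<^sub>R x \<in> S}"
proof -
  have "emeasure lborel S = emeasure (density (distr lborel borel (\<lambda>x. 0 + c *\<^sub>R x)) (\<lambda>_. ennreal (\<bar>c\<bar> ^ DIM('a)))) S"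
    using assms(1) by (subst lborel_affine[of c 0]) auto
  then show ?thesis
    using assms by (simp add: emeasure_density nn_integral_cmult emeasure_distr vimage_def)
qed

text \<open>It suffices to compare rectangles R x B. For fixed \<open>B\<close> both sides are
  measures in \<open>R\<close>, and they agree on half-lines: dilation preserves directions and
  multiplies volume by the n-th power of the factor.\<close>

lemma distr_lp_polar:
  assumes p: "0 < p"
  shows "radial_measure CARD('n) \<Otimes>\<^sub>M lp_surface p =
    distr lborel (borel \<Otimes>\<^sub>M borel) (\<lambda>x :: real ^ 'n. (lp_norm p x, lp_direction p x))"
proof -
  note [measurable] = borel_measurable_lp_direction[OF p] borel_measurable_lp_norm[OF p]
  interpret S: finite_measure "lp_surface p :: (real ^ 'n) measure"
    by (rule finite_measure_lp_surface[OF p])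
  show ?thesis
  proof (rule pair_measure_eqI)
    show "sigma_finite_measure (radial_measure CARD('n))"
      by (rule sigma_finite_radial_measure) simp
    show "sigma_finite_measure (lp_surface p :: (real ^ 'n) measure)"
      by (rule S.sigma_finite_measure_axioms)
    show "sets (radial_measure CARD('n) \<Otimes>\<^sub>M lp_surface p) =
      sets (distr lborel (borel \<Otimes>\<^sub>M borel) (\<lambda>x :: real ^ 'n. (lp_norm p x, lp_direction p x)))"
      by (simp cong: sets_pair_measure_cong)
    fix R :: "real set" and B :: "(real ^ 'n) set"
    assume "R \<in> sets (radial_measure CARD('n))" "B \<in> sets (lp_surface p)"
    then have [measurable]: "R \<in> sets borel" "B \<in> sets borel" by simp_all
    \<comment> \<open>Lebesgue measure restricted to the points with direction in \<open>B\<close>;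
      its image under the norm is compared with a multiple of the radial measure.\<close>
    define D where "D = density (lborel :: (real ^ 'n) measure) (\<lambda>x. indicator B (lp_direction p x))"
    have D_eq: "emeasure D {x. lp_norm p x \<in> S} = emeasure lborel {x. lp_norm p x \<in> S \<and> lp_direction p x \<in> B}"
      if [measurable]: "S \<in> sets borel" for S
    proof -
      have "emeasure D {x. lp_norm p x \<in> S} =
          (\<integral>\<^sup>+x. indicator B (lp_direction p x) * indicator {x. lp_norm p x \<in> S} x \<partial>lborel)"
        unfolding D_def by (rule emeasure_density) measurable
      also have "\<dots> = (\<integral>\<^sup>+x. indicator {x. lp_norm p x \<in> S \<and> lp_direction p x \<in> B} x \<partial>lborel)"
        by (intro nn_integral_cong) (auto simp: indicator_def)
      finally show ?thesis by simp
    qed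
    \<comment> \<open>Dilation by \<open>a\<close> carries the part of the unit ball with directions
      in \<open>B\<close> onto the corresponding part of the ball of radius
      \<open>a\<close>.\<close>
    have D_at: "emeasure D {x. lp_norm p x \<le> a} = ennreal ((max 0 a) ^ CARD('n)) * emeasure (lp_surface p) B" for a
    proof -
      have eq: "emeasure D {x. lp_norm p x \<le> a} = emeasure lborel {x. lp_norm p x \<le> a \<and> lp_direction p x \<in> B}"
        using D_eq[of "{..a}"] by simp
      show ?thesis
      proof (cases "0 < a")
        case True
        then have "{x. a *\<^sub>R x \<in> {x. lp_norm p x \<le> a \<and> lp_direction p x \<in> B}} =
            {x. lp_norm p x \<le> 1 \<and> lp_direction p x \<in> B}"
          by (auto simp: lp_norm_scaleR[OF p] lp_direction_scaleR[OF p])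
        then show ?thesis
          using True eq emeasure_lborel_scaleR_vimage[OF True, of "{x. lp_norm p x \<le> a \<and> lp_direction p x \<in> B}"]
          by (simp add: emeasure_lp_surface[OF p])
      next
        \<comment> \<open>For \<open>a \<le> 0\<close> at most the origin remains, and the
          right-hand side is 0 because \<open>max 0 a = 0\<close> and the dimension is
          positive.\<close>
        case False
        have "x = 0" if "lp_norm p x \<le> a" for x :: "real ^ 'n"
          using False that lp_norm_eq_0_iff[OF p, of x] lp_norm_nonneg[of p x] by linarith
        then have "emeasure lborel {x. lp_norm p x \<le> a \<and> lp_direction p x \<in> B} \<le> emeasure lborel {0 :: real ^ 'n}"
          by (intro emeasure_mono) auto
        then show ?thesis
          using False eq by (simp add: max_def)
      qed
    qed
    have "scale_measure (emeasure (lp_surface p) B) (radial_measure CARD('n)) = distr D borel (lp_norm p)"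
    proof (rule measure_eqI_generator_eq)
      show "Int_stable (range atMost :: real set set)"
        by (auto simp: Int_stable_def)
      show "sets (scale_measure (emeasure (lp_surface p) B) (radial_measure CARD('n))) = sigma_sets UNIV (range atMost)"
        "sets (distr D borel (lp_norm p)) = sigma_sets UNIV (range atMost)"
        by (simp_all add: borel_eq_atMost)
      show "range (\<lambda>i::nat. {..real i}) \<subseteq> range atMost" "(\<Union>i. {..real i}) = UNIV"
        by (auto simp: real_arch_simple)
      show "emeasure (scale_measure (emeasure (lp_surface p) B) (radial_measure CARD('n))) {..real i} \<noteq> \<infinity>" for i
        by (simp add: emeasure_radial_measure_atMost ennreal_mult_eq_top_iff)
      fix X :: "real set" assume "X \<in> range atMost"
      then obtain a where X: "X = {..a}" by auto
      have "emeasure (distr D borel (lp_norm p)) {..a} = emeasure D {x. lp_norm p x \<le> a}"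
        by (subst emeasure_distr) (auto simp: D_def vimage_def)
      then show "emeasure (scale_measure (emeasure (lp_surface p) B) (radial_measure CARD('n))) X
          = emeasure (distr D borel (lp_norm p)) X"
        by (simp add: X D_at emeasure_radial_measure_atMost mult.commute)
    qed auto
    then have "emeasure (lp_surface p) B * emeasure (radial_measure CARD('n)) R = emeasure (distr D borel (lp_norm p)) R"
      by (metis emeasure_scale_measure)
    also have "\<dots> = emeasure D {x. lp_norm p x \<in> R}"
      by (subst emeasure_distr) (auto simp: D_def vimage_def)
    also have "\<dots> = emeasure lborel {x. lp_norm p x \<in> R \<and> lp_direction p x \<in> B}"
      by (rule D_eq) measurable
    also have "\<dots> = emeasure (distr lborel (borel \<Otimes>\<^sub>M borel) (\<lambda>x :: real ^ 'n. (lp_norm p x, lp_direction p x))) (R \<times> B)"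
      by (subst emeasure_distr) (auto intro!: arg_cong[where f="emeasure _"])
    finally show "emeasure (radial_measure CARD('n)) R * emeasure (lp_surface p) B =
      emeasure (distr lborel (borel \<Otimes>\<^sub>M borel) (\<lambda>x :: real ^ 'n. (lp_norm p x, lp_direction p x))) (R \<times> B)"
      by (simp add: mult.commute)
  qed
qed

text \<open>Transport along norm and direction, followed by Tonelli. The direction is the outer
  variable so that the radial integral can be transformed along each ray separately.\<close>

lemma nn_integral_lp_polar:
  fixes F :: "real ^ 'n \<Rightarrow> ennreal"
  assumes p: "0 < p" and F[measurable]: "F \<in> borel_measurable borel"
  shows "(\<integral>\<^sup>+x. F x \<partial>lborel) =
    (\<integral>\<^sup>+u. (\<integral>\<^sup>+r. ennreal (real CARD('n) * r ^ (CARD('n) - 1)) * F (r *\<^sub>R u) * indicator {0<..} r \<partial>lborel) \<partial>lp_surface p)"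
proof -
  note [measurable] = borel_measurable_lp_direction[OF p] borel_measurable_lp_norm[OF p]
  interpret S: finite_measure "lp_surface p :: (real ^ 'n) measure"
    by (rule finite_measure_lp_surface[OF p])
  interpret R: sigma_finite_measure "radial_measure CARD('n)"
    by (rule sigma_finite_radial_measure) simp
  interpret RS: pair_sigma_finite "radial_measure CARD('n)" "lp_surface p :: (real ^ 'n) measure" ..
  \<comment> \<open>Norm times direction recovers \<open>x\<close> also at the origin, where both
    vanish.\<close>
  have "(\<integral>\<^sup>+x. F x \<partial>lborel) = (\<integral>\<^sup>+x. F (lp_norm p x *\<^sub>R lp_direction p x) \<partial>lborel)"
    using lp_norm_eq_0_iff[OF p] by (intro nn_integral_cong arg_cong[where f=F]) (auto simp: lp_direction_def)
  also have "\<dots> = (\<integral>\<^sup>+z. F (fst z *\<^sub>R snd z) \<partial>distr lborel (borel \<Otimes>\<^sub>M borel) (\<lambda>x :: real ^ 'n. (lp_norm p x, lp_direction p x)))"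
    by (subst nn_integral_distr) auto
  also have "\<dots> = (\<integral>\<^sup>+z. F (fst z *\<^sub>R snd z) \<partial>(radial_measure CARD('n) \<Otimes>\<^sub>M lp_surface p))"
    by (simp add: distr_lp_polar[OF p])
  also have "\<dots> = (\<integral>\<^sup>+u. (\<integral>\<^sup>+r. F (r *\<^sub>R u) \<partial>radial_measure CARD('n)) \<partial>lp_surface p)"
    by (subst RS.nn_integral_snd[symmetric]) auto
  also have "\<dots> = (\<integral>\<^sup>+u. (\<integral>\<^sup>+r. ennreal (real CARD('n) * r ^ (CARD('n) - 1)) * F (r *\<^sub>R u) * indicator {0<..} r \<partial>lborel) \<partial>lp_surface p)"
    by (intro nn_integral_cong) (simp add: radial_measure_def nn_integral_density mult_ac)
  finally show ?thesis .
qed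

subsection \<open>The image of the Gaussian-type density under rescaling\<close>

text \<open>Put r = s / (s^p + w)^(1/p). Then s^p = w r^p / (1 - r^p), which turns the exponential
  into that of \<open>psi\<close>, and s^(n-1) ds = w^(n/p) (1 - r^p)^(-n/p-1) r^(n-1) dr.\<close>

lemma nn_integral_radial_substitution:
  fixes q :: "real \<Rightarrow> ennreal" and n :: nat
  assumes p: "0 < p" and w: "0 < w" and n: "0 < n" and q[measurable]: "q \<in> borel_measurable borel"
  shows "(\<integral>\<^sup>+s. ennreal (real n * s ^ (n - 1)) *
      (ennreal (exp (- (s powr p))) * q ((1 / (s powr p + w) powr (1 / p)) * s)) * indicator {0<..} s \<partial>lborel) =
    (\<integral>\<^sup>+r. ennreal (real n * r ^ (n - 1)) *
      (ennreal (w powr (real n / p) * exp (- (r powr p * w / (1 - r powr p))) / (1 - r powr p) powr (real n / p + 1)) * q r) *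
      indicator {0<..<1} r \<partial>lborel)"
proof -
  \<comment> \<open>The inverse of the radial map, expressing s through r; \<open>\<phi>'\<close> is
    its derivative in simplified form.\<close>
  define \<phi> where "\<phi> r = w powr (1 / p) * (r * (1 - r powr p) powr (- (1 / p)))" for r
  define \<phi>' where "\<phi>' r = w powr (1 / p) * (1 - r powr p) powr (- (1 / p) - 1)" for r
  have less1: "0 < 1 - r powr p" if "0 < r" "r < 1" for r
    using powr_less_mono2[of p r 1] that p by simp
  have \<phi>'_nonneg: "0 \<le> \<phi>' r" for r
    by (simp add: \<phi>'_def)
  have deriv: "(\<phi> has_real_derivative \<phi>' r) (at r)" if r: "0 < r" "r < 1" for r
  proof -
    define v where "v = 1 - r powr p"
    have v: "0 < v" using less1[OF r] by (simp add: v_def)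
    have deriv0: "(\<phi> has_real_derivative w powr (1 / p) * (v powr (- (1 / p)) +
        r * (- (1 / p) * v powr (- (1 / p) - 1) * (- (p * r powr (p - 1)))))) (at r)"
      unfolding \<phi>_def v_def using r less1[OF r] p
      by (auto intro!: derivative_eq_intros simp: powr_diff field_simps)
    have v1: "v powr (- (1 / p)) = v * v powr (- (1 / p) - 1)"
      using v by (simp add: powr_diff)
    have "r * (- (1 / p) * v powr (- (1 / p) - 1) * (- (p * r powr (p - 1)))) =
        (r * r powr (p - 1)) * v powr (- (1 / p) - 1)"
      using p by simp
    also have "r * r powr (p - 1) = 1 - v"
      using r by (simp add: v_def powr_diff)
    finally have v2: "r * (- (1 / p) * v powr (- (1 / p) - 1) * (- (p * r powr (p - 1)))) =
        (1 - v) * v powr (- (1 / p) - 1)" .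
    \<comment> \<open>The two terms of the product rule are \<open>v\<close> and
      \<open>1 - v\<close> times the same power of \<open>v\<close>, so they add up to that
      power.\<close>
    have v3: "v powr (- (1 / p)) + r * (- (1 / p) * v powr (- (1 / p) - 1) * (- (p * r powr (p - 1)))) = v powr (- (1 / p) - 1)"
      unfolding v1 v2 by (simp add: algebra_simps)
    show ?thesis
      using deriv0 unfolding v3 by (simp only: \<phi>'_def v_def)
  qed
  have cont: "continuous_on {0<..<1} \<phi>'"
    unfolding \<phi>'_def by (intro continuous_intros) (use less1 in force)+
  have pos: "0 < \<phi> r" if "0 < r" "r < 1" for r
    using that w less1[OF that] unfolding \<phi>_def by (intro mult_pos_pos) auto
  have lim0: "(\<phi> \<longlongrightarrow> 0) (at_right 0)"
    unfolding \<phi>_def using p w by real_asymp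
  have lim1: "filterlim \<phi> at_top (at_left 1)"
    unfolding \<phi>_def using p w by real_asymp
  define f where "f s = ennreal (real n * s ^ (n - 1)) *
      (ennreal (exp (- (s powr p))) * q ((1 / (s powr p + w) powr (1 / p)) * s))" for s
  have [measurable]: "f \<in> borel_measurable borel"
    unfolding f_def by measurable
  have "(\<integral>\<^sup>+s. f s * indicator {0<..} s \<partial>lborel) =
      (\<integral>\<^sup>+r. f (\<phi> r) * ennreal (\<phi>' r) * indicator {0<..<1} r \<partial>lborel)"
    using w by (intro nn_integral_substitution_open deriv cont pos lim0 lim1) (auto simp: \<phi>'_nonneg)
  also have "\<dots> = (\<integral>\<^sup>+r. ennreal (real n * r ^ (n - 1)) *
      (ennreal (w powr (real n / p) * exp (- (r powr p * w / (1 - r powr p))) / (1 - r powr p) powr (real n / p + 1)) * q r) *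
      indicator {0<..<1} r \<partial>lborel)"
  proof (intro nn_integral_cong)
    fix r :: real
    show "f (\<phi> r) * ennreal (\<phi>' r) * indicator {0<..<1} r = ennreal (real n * r ^ (n - 1)) *
      (ennreal (w powr (real n / p) * exp (- (r powr p * w / (1 - r powr p))) / (1 - r powr p) powr (real n / p + 1)) * q r) *
      indicator {0<..<1} r"
    proof (cases "r \<in> {0<..<1}")
      case True
      define v where "v = 1 - r powr p"
      have v: "0 < v" and r: "0 < r" "r < 1" using less1 True by (auto simp: v_def)
      have \<phi>_eq: "\<phi> r = (w / v) powr (1 / p) * r"
        using v w by (simp add: \<phi>_def v_def[symmetric] powr_minus powr_divide field_simps)
      have \<phi>_powr: "\<phi> r powr p = r powr p * w / v"
        using v w r p by (simp add: \<phi>_eq powr_mult powr_powr)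
      \<comment> \<open>Here \<open>r powr p + v = 1\<close> enters; it makes the rescaling factor
        the exact inverse of the factor \<open>(w / v) powr (1 / p)\<close> in
        \<open>\<phi>\<close>.\<close>
      have "\<phi> r powr p + w = w / v"
        using v by (simp add: \<phi>_powr) (simp add: v_def field_simps)
      then have q_eq: "1 / (\<phi> r powr p + w) powr (1 / p) * \<phi> r = r"
        using v w by (simp add: \<phi>_eq)
      have "\<phi> r ^ (n - 1) = w powr (real (n - 1) / p) * v powr (- (real (n - 1) / p)) * r ^ (n - 1)"
        using v w r by (simp add: \<phi>_eq power_mult_distrib powr_divide powr_power powr_minus divide_simps)
      \<comment> \<open>The Jacobian: the exponents (n-1)/p and 1/p of \<open>w\<close> add up to
        n/p, and those of \<open>v\<close>, -(n-1)/p and -1/p - 1, to -(n/p + 1).\<close>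
      then have "\<phi> r ^ (n - 1) * \<phi>' r =
          (w powr (real (n - 1) / p) * w powr (1 / p)) * (v powr (- (real (n - 1) / p)) * v powr (- (1 / p) - 1)) * r ^ (n - 1)"
        by (simp add: \<phi>'_def v_def[symmetric] mult_ac)
      also have "w powr (real (n - 1) / p) * w powr (1 / p) = w powr (real n / p)"
        using n by (simp add: powr_add[symmetric] add_divide_distrib[symmetric])
      also have "v powr (- (real (n - 1) / p)) * v powr (- (1 / p) - 1) = v powr (- (real n / p + 1))"
      proof -
        have "- (real (n - 1) / p) + (- (1 / p) - 1) = - (real n / p + 1)"
          using n p by (simp add: of_nat_diff field_simps)
        then show ?thesis by (simp only: powr_add[symmetric])
      qed
      also have "\<dots> = 1 / v powr (real n / p + 1)"
        by (rule powr_minus_divide)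
      finally have jac: "\<phi> r ^ (n - 1) * \<phi>' r = r ^ (n - 1) * (w powr (real n / p) / v powr (real n / p + 1))"
        by simp
      have "f (\<phi> r) * ennreal (\<phi>' r) = ennreal (real n * (\<phi> r ^ (n - 1) * \<phi>' r) * exp (- (r powr p * w / v))) * q r"
      proof -
        \<comment> \<open>The real nonnegative factors are merged into one \<open>ennreal\<close>,
          while \<open>y\<close> stays outside because a value of \<open>q\<close> may be
          infinite.\<close>
        have "ennreal a * (ennreal e * y) * ennreal d = ennreal (real n * (b * d) * e) * y"
          if "a = real n * b" "0 \<le> b" "0 \<le> d" "0 \<le> e" for a b d e y
          using that by (simp add: ennreal_mult mult_ac)
        then show ?thesis
          unfolding f_def q_eq unfolding \<phi>_powr using pos[OF r] \<phi>'_nonneg[of r] by simp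
      qed
      also have "\<dots> = ennreal (real n * r ^ (n - 1)) *
        (ennreal (w powr (real n / p) * exp (- (r powr p * w / v)) / v powr (real n / p + 1)) * q r)"
      proof -
        have "real n * (r ^ (n - 1) * (w powr (real n / p) / v powr (real n / p + 1))) * exp (- (r powr p * w / v)) =
          (real n * r ^ (n - 1)) * (w powr (real n / p) * exp (- (r powr p * w / v)) / v powr (real n / p + 1))"
          by simp
        moreover have "ennreal ((real n * r ^ (n - 1)) * (w powr (real n / p) * exp (- (r powr p * w / v)) / v powr (real n / p + 1))) =
            ennreal (real n * r ^ (n - 1)) * ennreal (w powr (real n / p) * exp (- (r powr p * w / v)) / v powr (real n / p + 1))"
          using r by (intro ennreal_mult) auto
        ultimately show ?thesis
          unfolding jac by (simp only: mult.assoc)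
      qed
      finally show ?thesis by (simp add: v_def)
    qed simp
  qed
  finally show ?thesis by (simp add: f_def)
qed

text \<open>The rescaling depends on \<open>x\<close> only through its norm, so in polar coordinates
  it fixes the direction and acts on the radius by the substitution above.\<close>

lemma nn_integral_lp_rescaled:
  fixes F :: "real ^ 'n \<Rightarrow> ennreal"
  assumes p: "0 < p" and w: "0 < w" and F[measurable]: "F \<in> borel_measurable borel"
  shows "(\<integral>\<^sup>+x. ennreal (exp (- (lp_norm p x powr p))) *
      F ((1 / (lp_norm p x powr p + w) powr (1 / p)) *\<^sub>R x) \<partial>lborel) =
    (\<integral>\<^sup>+x. ennreal (w powr (real CARD('n) / p) * exp (- (lp_norm p x powr p * w / (1 - lp_norm p x powr p))) /
      (1 - lp_norm p x powr p) powr (real CARD('n) / p + 1)) * F x * indicator (lp_ball p) x \<partial>lborel)"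
proof -
  note [measurable] = borel_measurable_lp_norm[OF p, where ?'n='n] lp_ball_borel[OF p]
  let ?n = "CARD('n)"
  define K where "K r = ennreal (w powr (real ?n / p) * exp (- (r powr p * w / (1 - r powr p))) /
    (1 - r powr p) powr (real ?n / p + 1))" for r
  have [measurable]: "K \<in> borel_measurable borel"
    unfolding K_def by measurable
  let ?J = "\<lambda>r. ennreal (real ?n * r ^ (?n - 1))"
  have "(\<integral>\<^sup>+x. ennreal (exp (- (lp_norm p x powr p))) *
      F ((1 / (lp_norm p x powr p + w) powr (1 / p)) *\<^sub>R x) \<partial>lborel) =
    (\<integral>\<^sup>+u. (\<integral>\<^sup>+r. ?J r * (ennreal (exp (- (lp_norm p (r *\<^sub>R u) powr p))) *
      F ((1 / (lp_norm p (r *\<^sub>R u) powr p + w) powr (1 / p)) *\<^sub>R (r *\<^sub>R u))) * indicator {0<..} r \<partial>lborel) \<partial>lp_surface p)"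
    by (rule nn_integral_lp_polar[OF p]) measurable
  also have "\<dots> = (\<integral>\<^sup>+u. (\<integral>\<^sup>+r. ?J r * (K (lp_norm p (r *\<^sub>R u)) * F (r *\<^sub>R u) * indicator (lp_ball p) (r *\<^sub>R u)) *
      indicator {0<..} r \<partial>lborel) \<partial>lp_surface p)"
  proof (rule nn_integral_cong_AE, rule eventually_mono[OF AE_lp_surface[OF p]])
    fix u :: "real ^ 'n" assume u: "lp_norm p u = 1"
    have N: "lp_norm p (r *\<^sub>R u) = r" if "0 < r" for r
      using that u by (simp add: lp_norm_scaleR[OF p])
    have "(\<integral>\<^sup>+r. ?J r * (ennreal (exp (- (lp_norm p (r *\<^sub>R u) powr p))) *
      F ((1 / (lp_norm p (r *\<^sub>R u) powr p + w) powr (1 / p)) *\<^sub>R (r *\<^sub>R u))) * indicator {0<..} r \<partial>lborel) =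
      (\<integral>\<^sup>+r. ?J r * (ennreal (exp (- (r powr p))) *
      F ((1 / (r powr p + w) powr (1 / p) * r) *\<^sub>R u)) * indicator {0<..} r \<partial>lborel)"
      by (intro nn_integral_cong) (auto simp: N indicator_def)
    also have "\<dots> = (\<integral>\<^sup>+r. ?J r * (K r * F (r *\<^sub>R u)) * indicator {0<..<1} r \<partial>lborel)"
      unfolding K_def by (rule nn_integral_radial_substitution[OF p w]) auto
    \<comment> \<open>The closed ball adds the radius 1 to the open interval, a single point and
      hence a null set.\<close>
    also have "\<dots> = (\<integral>\<^sup>+r. ?J r * (K (lp_norm p (r *\<^sub>R u)) * F (r *\<^sub>R u) * indicator (lp_ball p) (r *\<^sub>R u)) *
      indicator {0<..} r \<partial>lborel)"
      using AE_lborel_singleton[of "1::real"]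
      by (intro nn_integral_cong_AE) (auto elim!: eventually_mono simp: N indicator_def lp_ball_def)
    finally show "(\<integral>\<^sup>+r. ?J r * (ennreal (exp (- (lp_norm p (r *\<^sub>R u) powr p))) *
      F ((1 / (lp_norm p (r *\<^sub>R u) powr p + w) powr (1 / p)) *\<^sub>R (r *\<^sub>R u))) * indicator {0<..} r \<partial>lborel) = \<dots>" .
  qed
  also have "\<dots> = (\<integral>\<^sup>+x. K (lp_norm p x) * F x * indicator (lp_ball p) x \<partial>lborel)"
    by (rule nn_integral_lp_polar[OF p, symmetric]) measurable
  finally show ?thesis unfolding K_def .
qed

text \<open>The case w = 0: a nonzero point is sent to its direction, so the integrand splits into a
  function of the radius times \<open>F u\<close>, and the integral factorises.\<close>

lemma nn_integral_lp_projected: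
  fixes F :: "real ^ 'n \<Rightarrow> ennreal"
  assumes p: "0 < p" and F[measurable]: "F \<in> borel_measurable borel"
  shows "(\<integral>\<^sup>+x. ennreal (exp (- (lp_norm p x powr p))) *
      F ((1 / (lp_norm p x powr p) powr (1 / p)) *\<^sub>R x) \<partial>lborel) =
    (\<integral>\<^sup>+r. ennreal (real CARD('n) * r ^ (CARD('n) - 1)) * ennreal (exp (- (r powr p))) * indicator {0<..} r \<partial>lborel) *
    (\<integral>\<^sup>+u. F u \<partial>lp_surface p)"
proof -
  note [measurable] = borel_measurable_lp_norm[OF p, where ?'n='n]
  let ?J = "\<lambda>r. ennreal (real CARD('n) * r ^ (CARD('n) - 1))"
  have "(\<integral>\<^sup>+x. ennreal (exp (- (lp_norm p x powr p))) *
      F ((1 / (lp_norm p x powr p) powr (1 / p)) *\<^sub>R x) \<partial>lborel) =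
    (\<integral>\<^sup>+u. (\<integral>\<^sup>+r. ?J r * (ennreal (exp (- (lp_norm p (r *\<^sub>R u) powr p))) *
      F ((1 / (lp_norm p (r *\<^sub>R u) powr p) powr (1 / p)) *\<^sub>R (r *\<^sub>R u))) * indicator {0<..} r \<partial>lborel) \<partial>lp_surface p)"
    by (rule nn_integral_lp_polar[OF p]) measurable
  also have "\<dots> = (\<integral>\<^sup>+u. (\<integral>\<^sup>+r. ?J r * ennreal (exp (- (r powr p))) * indicator {0<..} r * F u \<partial>lborel) \<partial>lp_surface p)"
    by (rule nn_integral_cong_AE, rule eventually_mono[OF AE_lp_surface[OF p]], rule nn_integral_cong)
      (use p in \<open>auto simp: lp_norm_scaleR powr_powr indicator_def mult_ac\<close>)
  also have "\<dots> = (\<integral>\<^sup>+r. ?J r * ennreal (exp (- (r powr p))) * indicator {0<..} r \<partial>lborel) * (\<integral>\<^sup>+u. F u \<partial>lp_surface p)"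
    by (simp add: nn_integral_multc nn_integral_cmult)
  finally show ?thesis .
qed

text \<open>The exponents of the coordinate densities sum to the p-th power of the norm, so the
  joint density is radial; this is what makes polar coordinates applicable.\<close>

lemma density_lp_gaussian:
  assumes p: "0 < p"
  shows "(\<Prod>i\<in>(UNIV :: 'n::finite set). ennreal (exp (- (\<bar>x $ i\<bar> powr p)) / (2 * Gamma (1 + 1 / p)))) =
    ennreal (exp (- (lp_norm p x powr p))) / ennreal ((2 * Gamma (1 + 1 / p)) ^ CARD('n))"
proof -
  have G: "0 < Gamma (1 + 1 / p)"
    using p by (intro Gamma_real_pos) (simp add: add_pos_pos)
  then have "(\<Prod>i\<in>(UNIV :: 'n set). ennreal (exp (- (\<bar>x $ i\<bar> powr p)) / (2 * Gamma (1 + 1 / p)))) =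
    ennreal (\<Prod>i\<in>(UNIV :: 'n set). exp (- (\<bar>x $ i\<bar> powr p)) / (2 * Gamma (1 + 1 / p)))"
    by (intro prod_ennreal) auto
  also have "(\<Prod>i\<in>(UNIV :: 'n set). exp (- (\<bar>x $ i\<bar> powr p)) / (2 * Gamma (1 + 1 / p))) =
     exp (- (lp_norm p x powr p)) / (2 * Gamma (1 + 1 / p)) ^ CARD('n)"
    by (simp add: prod_dividef exp_sum[symmetric] sum_negf lp_norm_powr[OF p])
  finally show ?thesis
    using G by (simp add: divide_ennreal)
qed

text \<open>Equality of laws is stated on each Borel set because the right-hand side is a sum of two
  measures. The default value of \<open>psi\<close> at radius 1 is harmless, since the sphere is
  Lebesgue null.\<close>

theorem theorem3:
  fixes p :: real
    and M :: "'a measure"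
    and G :: "'a \<Rightarrow> real ^ 'n"
    and W :: "'a \<Rightarrow> real"
    and h :: "real measure"
  assumes "0 < p"
    and "prob_space M"
    and "prob_space.indep_vars M (\<lambda>_. borel) (\<lambda>i \<omega>. G \<omega> $ i) UNIV"
    and "\<And>i. distributed M lborel (\<lambda>\<omega>. G \<omega> $ i)
          (\<lambda>t. ennreal (exp (- (\<bar>t\<bar> powr p)) / (2 * Gamma (1 + 1 / p))))"
    and "W \<in> borel_measurable M"
    and "AE \<omega> in M. 0 \<le> W \<omega>"
    and "prob_space.indep_set M {G -` S \<inter> space M |S. S \<in> sets borel}
          {W -` S \<inter> space M |S. S \<in> sets borel}"
    and "h = distr M borel W"
    and "A \<in> sets borel"
  shows "emeasure (distr M borel
            (\<lambda>\<omega>. (1 / (lp_norm p (G \<omega>) powr p + W \<omega>) powr (1 / p)) *\<^sub>R G \<omega>)) A =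
         emeasure h {0} * emeasure (cone_measure (lp_ball p)) A +
         emeasure (density (density lborel (indicator (lp_ball p)))
            (\<lambda>x. psi p CARD('n) h (lp_norm p x))) A"
proof -
  note p = assms(1)
  note [measurable] = assms(5) assms(9) borel_measurable_lp_norm[OF p, where ?'n='n] lp_ball_borel[OF p, where 'n='n]
  interpret prob_space M by fact
  let ?n = "CARD('n)"
  let ?N = "lp_norm p :: real ^ 'n \<Rightarrow> real"
  have "(\<lambda>\<omega>. G \<omega> $ i) \<in> borel_measurable M" for i
    using distributed_measurable[OF assms(4)[of i]] by simp
  then have G[measurable]: "G \<in> borel_measurable M"
    by (subst borel_measurable_euclidean_space) (auto simp: Basis_vec_def inner_axis)

  define c where "c = ennreal (1 / (2 * Gamma (1 + 1 / p)) ^ ?n)"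
  have Gamma_pos: "0 < Gamma (1 + 1 / p)"
    using p by (intro Gamma_real_pos) (simp add: add_pos_pos)
  define E where "E x = ennreal (exp (- (?N x powr p)))" for x
  have [measurable]: "E \<in> borel_measurable borel"
    unfolding E_def by measurable
  have distr_G: "distr M borel G = density lborel (\<lambda>x. c * E x)"
    unfolding distr_vec_eq_density[OF assms(2-4) G] density_lp_gaussian[OF p] E_def c_def
    using Gamma_pos by (intro arg_cong[where f="density lborel"] ext)
      (simp add: divide_ennreal ennreal_mult'[symmetric])

  have h: "prob_space h" "sets h = sets borel" "space h = UNIV"
    by (auto simp: assms(8) intro!: prob_space_distr)
  interpret H: prob_space h by (rule h)
  note [measurable_cong] = h(2)
  have h_nonneg: "AE w in h. 0 \<le> w"
    using assms(6) unfolding assms(8) by (subst AE_distr_iff) auto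

  \<comment> \<open>The joint law of \<open>G\<close> and \<open>W\<close>\<close>
  interpret DG: prob_space "distr M borel G" by (intro prob_space_distr G)
  \<comment> \<open>Independence gives the product formula on rectangles, which determines a product
    of sigma-finite measures.\<close>
  have joint: "distr M borel G \<Otimes>\<^sub>M h = distr M (borel \<Otimes>\<^sub>M borel) (\<lambda>\<omega>. (G \<omega>, W \<omega>))"
  proof (rule pair_measure_eqI)
    fix S T assume "S \<in> sets (distr M borel G)" "T \<in> sets h"
    then have [measurable]: "S \<in> sets borel" "T \<in> sets borel" by (simp_all add: h)
    have "emeasure (distr M (borel \<Otimes>\<^sub>M borel) (\<lambda>\<omega>. (G \<omega>, W \<omega>))) (S \<times> T) =
        emeasure M ((G -` S \<inter> space M) \<inter> (W -` T \<inter> space M))"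
      by (subst emeasure_distr) (auto intro!: arg_cong[where f="emeasure M"])
    also have "\<dots> = ennreal (prob (G -` S \<inter> space M) * prob (W -` T \<inter> space M))"
      unfolding emeasure_eq_measure
    proof (rule arg_cong[where f=ennreal])
      have "G -` S \<inter> space M \<in> {G -` S \<inter> space M |S. S \<in> sets borel}"
        "W -` T \<inter> space M \<in> {W -` S \<inter> space M |S. S \<in> sets borel}"
        by auto
      then show "prob ((G -` S \<inter> space M) \<inter> (W -` T \<inter> space M)) = prob (G -` S \<inter> space M) * prob (W -` T \<inter> space M)"
        by (rule assms(7)[unfolded indep_sets2_eq, THEN conjunct2, THEN conjunct2, THEN bspec, THEN bspec])
    qed
    finally show "emeasure (distr M borel G) S * emeasure h T =
        emeasure (distr M (borel \<Otimes>\<^sub>M borel) (\<lambda>\<omega>. (G \<omega>, W \<omega>))) (S \<times> T)"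
      by (simp add: assms(8) emeasure_distr emeasure_eq_measure ennreal_mult)
  next
    show "sets (distr M borel G \<Otimes>\<^sub>M h) = sets (distr M (borel \<Otimes>\<^sub>M borel) (\<lambda>\<omega>. (G \<omega>, W \<omega>)))"
      unfolding sets_distr by (rule sets_pair_measure_cong) (simp_all add: h)
  qed (rule DG.sigma_finite_measure_axioms H.sigma_finite_measure_axioms)+

  \<comment> \<open>Integrating out \<open>G\<close> for a fixed value of \<open>W\<close>\<close>
  define T where "T x w = (1 / (?N x powr p + w) powr (1 / p)) *\<^sub>R x" for x w
  have [measurable]: "(\<lambda>z. T (fst z) (snd z)) \<in> borel_measurable (borel \<Otimes>\<^sub>M borel)"
    unfolding T_def by measurable
  have T2[measurable]: "(\<lambda>x. T x w) \<in> borel_measurable borel" for w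
    unfolding T_def by measurable
  interpret LH: pair_sigma_finite "distr M borel G" h ..
  \<comment> \<open>Up to the factor \<open>c\<close>, the probability of landing in
    \<open>A\<close> given \<open>W = w\<close>.\<close>
  define L where "L w = (\<integral>\<^sup>+x. E x * indicator A (T x w) \<partial>lborel)" for w
  have "emeasure (distr M borel (\<lambda>\<omega>. T (G \<omega>) (W \<omega>))) A =
    (\<integral>\<^sup>+\<omega>. indicator A (T (G \<omega>) (W \<omega>)) \<partial>M)"
    by (subst nn_integral_distr[symmetric, of "\<lambda>\<omega>. T (G \<omega>) (W \<omega>)" M borel "indicator A"])
      (auto simp: T_def)
  also have "\<dots> = (\<integral>\<^sup>+z. indicator A (T (fst z) (snd z)) \<partial>distr M (borel \<Otimes>\<^sub>M borel) (\<lambda>\<omega>. (G \<omega>, W \<omega>)))"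
    by (subst nn_integral_distr) auto
  also have "\<dots> = (\<integral>\<^sup>+w. (\<integral>\<^sup>+x. indicator A (T x w) \<partial>distr M borel G) \<partial>h)"
    unfolding joint[symmetric] by (subst LH.nn_integral_snd[symmetric]) auto
  also have "\<dots> = (\<integral>\<^sup>+w. c * L w \<partial>h)"
    unfolding distr_G L_def
    by (intro nn_integral_cong) (simp add: nn_integral_density nn_integral_cmult[symmetric] mult.assoc)
  finally have lhs: "emeasure (distr M borel (\<lambda>\<omega>. T (G \<omega>) (W \<omega>))) A = (\<integral>\<^sup>+w. c * L w \<partial>h)" .

  \<comment> \<open>The atom at w = 0\<close>
  define I where "I = (\<integral>\<^sup>+r. ennreal (real ?n * r ^ (?n - 1)) * ennreal (exp (- (r powr p))) * indicator {0<..} r \<partial>lborel)"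
  define V where "V = emeasure lborel (lp_ball p :: (real ^ 'n) set)"
  \<comment> \<open>Stated for every \<open>B\<close>: the choice \<open>UNIV\<close> fixes the
    constant through total mass 1, the choice \<open>A\<close> then gives the cone measure.\<close>
  have L0: "(\<integral>\<^sup>+x. E x * indicator B (T x 0) \<partial>lborel) = I * emeasure (lp_surface p) B" if "B \<in> sets borel" for B
    using nn_integral_lp_projected[OF p, of "indicator B"] that by (simp add: E_def T_def I_def)
  have "1 = emeasure (distr M borel G) UNIV"
    using DG.emeasure_space_1 by simp
  also have "\<dots> = c * (\<integral>\<^sup>+x. E x \<partial>lborel)"
    unfolding distr_G by (simp add: emeasure_density nn_integral_cmult)
  also have "(\<integral>\<^sup>+x. E x \<partial>lborel) = I * V"
    using L0[of UNIV] emeasure_lp_surface_UNIV[OF p, where 'n='n] by (simp add: V_def)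
  finally have norm: "c * I * V = 1" by (simp add: mult.assoc)
  \<comment> \<open>Cancelling \<open>V\<close> in \<open>ennreal\<close> requires it to be neither
    0 nor infinite.\<close>
  have "V \<noteq> 0" using norm by auto
  moreover have "V \<noteq> \<infinity>" using emeasure_lp_ball_finite[OF p, where 'n='n] by (simp add: V_def)
  ultimately have cI: "c * I = 1 / V"
    using norm by (metis ennreal_mult_divide_eq infinity_ennreal_def)
  have cL0: "c * L 0 = emeasure (cone_measure (lp_ball p)) A"
    using cI L0[of A] unfolding L_def
    by (simp add: emeasure_cone_measure_eq_lp_surface[OF p] V_def[symmetric] divide_ennreal_def mult.assoc[symmetric])
      (simp add: mult.commute)

  \<comment> \<open>The absolutely continuous part, w > 0\<close>
  define K where "K w r = ennreal (w powr (real ?n / p) * exp (- (r powr p * w / (1 - r powr p))) /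
      (1 - r powr p) powr (real ?n / p + 1))" for w r
  have [measurable]: "(\<lambda>z. K (fst z) (?N (snd z))) \<in> borel_measurable (borel \<Otimes>\<^sub>M borel)"
    "(\<lambda>z. K (snd z) (?N (fst z))) \<in> borel_measurable (borel \<Otimes>\<^sub>M borel)"
    "(\<lambda>w. K w r) \<in> borel_measurable borel" for r
    unfolding K_def by measurable
  have Lw: "L w = (\<integral>\<^sup>+x. K w (?N x) * indicator A x * indicator (lp_ball p) x \<partial>lborel)" if "0 < w" for w
    using nn_integral_lp_rescaled[OF p that, of "indicator A"] by (simp add: L_def E_def T_def K_def)
  \<comment> \<open>The power of 1 - r^p does not depend on \<open>w\<close> and moves inside the
    integral; \<open>c\<close> is the reciprocal of the Gamma factor. All this is done in
    \<open>ennreal\<close>, as the integral may be infinite at r = 0.\<close>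
  have psi: "psi p ?n h r = c * (\<integral>\<^sup>+w. K w r * indicator {0<..} w \<partial>h)" for r
  proof -
    have "(\<integral>\<^sup>+w. K w r * indicator {0<..} w \<partial>h) = ennreal (1 / (1 - r powr p) powr (real ?n / p + 1)) *
      (\<integral>\<^sup>+ w \<in> {0<..}. ennreal (w powr (real ?n / p) * exp (- (r powr p * w / (1 - r powr p)))) \<partial>h)"
      by (subst nn_integral_cmult[symmetric])
        (auto simp: K_def mult.assoc[symmetric] ennreal_mult'[symmetric] intro!: nn_integral_cong)
    then show ?thesis
      using Gamma_pos by (simp add: psi_def c_def divide_ennreal_def inverse_ennreal mult.commute divide_inverse)
  qed
  interpret HL: pair_sigma_finite h "lborel :: (real ^ 'n) measure" ..
  have [measurable]: "(\<lambda>x. \<integral>\<^sup>+w. K w (?N x) * indicator {0<..} w \<partial>h) \<in> borel_measurable borel"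
    by (rule H.borel_measurable_nn_integral) measurable
  have [measurable]: "(\<lambda>x. \<integral>\<^sup>+w. K w (?N x) * indicator A x * indicator (lp_ball p) x * indicator {0<..} w \<partial>h) \<in> borel_measurable borel"
    by (rule H.borel_measurable_nn_integral) measurable
  have Q: "(\<lambda>(w, x). K w (?N x) * indicator A x * indicator (lp_ball p) x * indicator {0<..} w) \<in> borel_measurable (h \<Otimes>\<^sub>M lborel)"
    by measurable
  have [measurable]: "(\<lambda>w. \<integral>\<^sup>+x. K w (?N x) * indicator A x * indicator (lp_ball p) x * indicator {0<..} w \<partial>lborel) \<in> borel_measurable h"
    using Q by (rule lborel.borel_measurable_nn_integral)
  \<comment> \<open>Since \<open>W\<close> is almost surely nonnegative, the integral over
    \<open>h\<close> splits into the atom at 0 and the part on \<open>{0<..}\<close>.\<close>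
  have "(\<integral>\<^sup>+w. c * L w \<partial>h) = (\<integral>\<^sup>+w. c * L 0 * indicator {0} w + c * (L w * indicator {0<..} w) \<partial>h)"
    using h_nonneg by (intro nn_integral_cong_AE) (auto elim!: eventually_mono simp: indicator_def)
  also have "\<dots> = (\<integral>\<^sup>+w. c * L 0 * indicator {0} w + c * (\<integral>\<^sup>+x. K w (?N x) * indicator A x * indicator (lp_ball p) x * indicator {0<..} w \<partial>lborel) \<partial>h)"
    by (intro nn_integral_cong) (auto simp: Lw indicator_def)
  also have "\<dots> = c * L 0 * emeasure h {0} + c * (\<integral>\<^sup>+w. \<integral>\<^sup>+x. K w (?N x) * indicator A x * indicator (lp_ball p) x * indicator {0<..} w \<partial>lborel \<partial>h)"
    by (subst nn_integral_add) (auto simp: nn_integral_cmult)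
  \<comment> \<open>After exchanging the integrals the inner one runs over \<open>w\<close> with
    \<open>x\<close> fixed, which is the integral in \<open>psi\<close> at the norm of
    \<open>x\<close>.\<close>
  also have "(\<integral>\<^sup>+w. \<integral>\<^sup>+x. K w (?N x) * indicator A x * indicator (lp_ball p) x * indicator {0<..} w \<partial>lborel \<partial>h) =
    (\<integral>\<^sup>+x. \<integral>\<^sup>+w. K w (?N x) * indicator A x * indicator (lp_ball p) x * indicator {0<..} w \<partial>h \<partial>lborel)"
    by (rule HL.Fubini'[OF Q, symmetric])
  also have "c * \<dots> = (\<integral>\<^sup>+x. indicator (lp_ball p) x * (psi p ?n h (?N x) * indicator A x) \<partial>lborel)"
  proof (subst nn_integral_cmult[symmetric], measurable, intro nn_integral_cong)
    fix x
    have "(\<integral>\<^sup>+w. K w (?N x) * indicator A x * indicator (lp_ball p) x * indicator {0<..} w \<partial>h) =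
        (\<integral>\<^sup>+w. K w (?N x) * indicator {0<..} w * (indicator A x * indicator (lp_ball p) x) \<partial>h)"
      by (simp add: mult_ac)
    also have "\<dots> = (\<integral>\<^sup>+w. K w (?N x) * indicator {0<..} w \<partial>h) * (indicator A x * indicator (lp_ball p) x)"
      by (rule nn_integral_multc) measurable
    finally show "c * (\<integral>\<^sup>+w. K w (?N x) * indicator A x * indicator (lp_ball p) x * indicator {0<..} w \<partial>h) =
        indicator (lp_ball p) x * (psi p ?n h (?N x) * indicator A x)"
      by (simp add: psi mult_ac)
  qed
  also have "\<dots> = emeasure (density (density lborel (indicator (lp_ball p))) (\<lambda>x. psi p ?n h (?N x))) A"
    unfolding psi by (simp add: emeasure_density nn_integral_density)
  finally show ?thesis
    using lhs cL0 by (simp add: T_def mult.commute)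
qed

end
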